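(* Let $\Lambda$ be a finite or countably infinite set with at least two elements and let $A=(A_{x,y})_{x,y\in\Lambda}$ be the conservative generator of a continuous-time Markov chain $(X_t)_{t\in[0,\infty)}$ on $\Lambda$. Assume that $A$ is symmetric. Fix a finite subset $S$ of $\Lambda$. Then, for any $T\ge1$ and any $a\in S$, the following bounds hold. (i) For every measurable $\Gamma\subseteq\mathcal{M}_1(S)$, $$\log\mathbb{P}_a\Big(\tfrac1T\ell_T\in\Gamma,\;R_T\subseteq S\Big)\le-T\inf_{\mu\in\Gamma}\big\|(-A)^{1/2}\sqrt{\mu}\big\|_2^2+|S|\log\big(\eta_S\sqrt{8e}\,T\big)+\log|S|+\frac{|S|}{4T}.$$ (ii) For every measurable functional $F:\mathcal{M}_1(S)\to\mathbb{R}$, $$\log\mathbb{E}_a\Big[e^{TF(\frac1T\ell_T)}\mathbb{1}_{\{R_T\subseteq S\}}\Big]\le T\sup_{\mu\in\mathcal{M}_1(S)}\Big[F(\mu)-\big\|(-A)^{1/2}\sqrt{\mu}\big\|_2^2\Big]+|S|\log\big(\eta_S\sqrt{8e}\,T\big)+\log|S|+\frac{|S|}{4T}.$$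
   Context: $A$ is a conservative generator: $A_{x,y}\ge0$ for $x\ne y$, and each row sums to $0$. Under $\mathbb{P}_a$ (expectation $\mathbb{E}_a$) the chain starts at $X_0=a$. Local times: $\ell_T(x)=\int_0^T\mathbb{1}_{\{X_s=x\}}\,ds$, $x\in\Lambda$. Range: $R_T=\mathrm{supp}(\ell_T)=\{X_s:s\in[0,T]\}$. $\mathcal{M}_1(S)$ is the set of probability measures on $S$, regarded also as probability measures on $\Lambda$ vanishing outside $S$; on $\{R_T\subseteq S\}$ we have $\frac1T\ell_T\in\mathcal{M}_1(S)$. For $\mu\in\mathcal{M}_1(S)$, $\|(-A)^{1/2}\sqrt{\mu}\|_2^2$ is the Dirichlet form of $A$ applied to $\sqrt\mu$, i.e. $-\sum_{x,y\in S}A_{x,y}\sqrt{\mu(x)}\sqrt{\mu(y)}$. With $B=([1-\delta_{x,y}]A_{x,y})_{x,y\in\Lambda}$ the off-diagonal part of $A$, $$\eta_S=\max\Big\{\max_{x\in S}\sum_{y\in S\setminus\{x\}}|B_{x,y}|,\;\max_{y\in S}\sum_{x\in S\setminus\{y\}}|B_{x,y}|,\;1\Big\}.$$ Conventions: $\log 0=-\infty$ and $\inf\emptyset=+\infty$. *)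

theory Defs
  imports "HOL-Probability.Probability"
begin

section \<open>Continuous-time Markov chains\<close>

text \<open>
  The state space \<open>\<Lambda>\<close> is a type of class \<^class>\<open>countable\<close>, i.e. finite or
  countably infinite; subsets of \<open>\<Lambda>\<close> carry the discrete topology and sigma-algebra.
\<close>

definition conservative_generator :: "('a::countable \<Rightarrow> 'a \<Rightarrow> real) \<Rightarrow> bool" where
  "conservative_generator A \<longleftrightarrow>
     (\<forall>x y. x \<noteq> y \<longrightarrow> A x y \<ge> 0) \<and> (\<forall>x. (A x has_sum 0) UNIV)"

text \<open>
  The family \<open>P a\<close> (start in \<open>a\<close>) of probability measures lives on one common measurable
  space. The paths have values in \<open>\<Lambda>\<close> for all times and are right-continuous in the
  discrete topology. The transition function is \<open>p\<^sub>t(x,y) = P x {X t = y}\<close>; the Markov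
  property is stated with respect to the natural filtration of \<open>X\<close>, and \<open>A\<close> is the
  entrywise (right) derivative of \<open>p\<^sub>t\<close> at \<open>t = 0\<close>. Values \<open>X t\<close> with \<open>t < 0\<close> are never used.
\<close>

locale markov_chain_with_generator =
  fixes A :: "'a::countable \<Rightarrow> 'a \<Rightarrow> real"
    and P :: "'a \<Rightarrow> 'w measure"
    and X :: "real \<Rightarrow> 'w \<Rightarrow> 'a"
  assumes conservative: "conservative_generator A"
    and prob_space: "\<And>a. prob_space (P a)"
    and sets_eq: "\<And>a b. sets (P a) = sets (P b)"
    and measurable_X: "\<And>a t. 0 \<le> t \<Longrightarrow> X t \<in> P a \<rightarrow>\<^sub>M count_space UNIV"
    and right_continuous:
      "\<And>a \<omega> t. \<omega> \<in> space (P a) \<Longrightarrow> 0 \<le> t \<Longrightarrow> \<forall>\<^sub>F s in at_right t. X s \<omega> = X t \<omega>"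
    and initial: "\<And>a. AE \<omega> in P a. X 0 \<omega> = a"
    and markov:
      "\<And>a s t E x y. 0 \<le> s \<Longrightarrow> 0 \<le> t \<Longrightarrow>
         E \<in> sigma_sets (space (P a))
               {X u -` {z} \<inter> space (P a) | u z. 0 \<le> u \<and> u \<le> s} \<Longrightarrow>
         measure (P a) {\<omega> \<in> E. X s \<omega> = x \<and> X (s + t) \<omega> = y} =
         measure (P a) {\<omega> \<in> E. X s \<omega> = x} * measure (P x) {\<omega> \<in> space (P x). X t \<omega> = y}"
    and generator:
      "\<And>x y. ((\<lambda>t. measure (P x) {\<omega> \<in> space (P x). X t \<omega> = y})
               has_real_derivative A x y) (at 0 within {0..})"

section \<open>Local times and range\<close>

definition local_time :: "(real \<Rightarrow> 'w \<Rightarrow> 'a) \<Rightarrow> real \<Rightarrow> 'w \<Rightarrow> 'a \<Rightarrow> real" where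
  "local_time X T \<omega> x = (LBINT s:{0..T}. indicator {x} (X s \<omega>))"

definition occupation :: "(real \<Rightarrow> 'w \<Rightarrow> 'a) \<Rightarrow> real \<Rightarrow> 'w \<Rightarrow> 'a \<Rightarrow> real" where
  "occupation X T \<omega> = (\<lambda>x. local_time X T \<omega> x / T)"

definition chain_range :: "(real \<Rightarrow> 'w \<Rightarrow> 'a) \<Rightarrow> real \<Rightarrow> 'w \<Rightarrow> 'a set" where
  "chain_range X T \<omega> = {x. local_time X T \<omega> x \<noteq> 0}"

text \<open>
  The support of the local times is the set of states visited during \<open>[0,T)\<close>. It differs from
  \<open>{X s \<omega> | s. 0 \<le> s \<le> T}\<close> only if the path jumps to a new state exactly at time \<open>T\<close>, which
  is a null event.
\<close>

lemma chain_range_eq: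
  assumes rc: "\<And>t. 0 \<le> t \<Longrightarrow> \<forall>\<^sub>F s in at_right t. X s \<omega> = X t \<omega>"
  shows "chain_range X T \<omega> = (\<lambda>s. X s \<omega>) ` {0..<T}"
proof (intro set_eqI iffI)
  fix x assume "x \<in> chain_range X T \<omega>"
  then have nz: "(LBINT s:{0..T}. indicator {x} (X s \<omega>) :: real) \<noteq> 0"
    by (simp add: chain_range_def local_time_def)
  show "x \<in> (\<lambda>s. X s \<omega>) ` {0..<T}"
  proof (rule ccontr)
    assume "x \<notin> (\<lambda>s. X s \<omega>) ` {0..<T}"
    then have "\<And>s. s \<noteq> T \<Longrightarrow> indicator {0..T} s *\<^sub>R (indicator {x} (X s \<omega>) :: real) = 0"
      by (auto simp: indicator_def image_iff)
    then have "AE s in lborel. indicator {0..T} s *\<^sub>R (indicator {x} (X s \<omega>) :: real) = 0"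
      using AE_lborel_singleton[of T] by (auto elim: eventually_mono)
    with nz show False
      unfolding set_lebesgue_integral_def by (simp add: integral_eq_zero_AE)
  qed
next
  fix x assume "x \<in> (\<lambda>s. X s \<omega>) ` {0..<T}"
  then obtain t where t: "0 \<le> t" "t < T" and xt: "x = X t \<omega>" by auto
  define f where "f s = (indicator {x} (X (max 0 s) \<omega>) :: real)" for s
  define d where "d n s = (of_int \<lfloor>real (Suc n) * s\<rfloor> + 1) / real (Suc n)" for n s
  have d_gt: "d n s > s" for n s
  proof -
    have "real (Suc n) * s < of_int \<lfloor>real (Suc n) * s\<rfloor> + 1" by linarith
    then show ?thesis unfolding d_def by (subst pos_less_divide_eq) (simp_all add: mult.commute)
  qed
  have d_le: "d n s \<le> s + 1 / real (Suc n)" for n s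
  proof -
    have "of_int \<lfloor>real (Suc n) * s\<rfloor> / real (Suc n) \<le> s"
      by (subst pos_divide_le_eq) (simp_all add: mult.commute[of s] del: of_nat_Suc)
    then show ?thesis unfolding d_def add_divide_distrib by simp
  qed
  have d_lim: "(\<lambda>n. d n s) \<longlonglongrightarrow> s" for s
  proof (rule tendsto_sandwich[where f = "\<lambda>_. s" and h = "\<lambda>n. s + 1 / real (Suc n)"])
    show "(\<lambda>n. s + 1 / real (Suc n)) \<longlonglongrightarrow> s"
      using tendsto_add[OF tendsto_const LIMSEQ_inverse_real_of_nat, of s]
      by (simp add: inverse_eq_divide)
  qed (simp_all add: d_gt less_imp_le d_le del: of_nat_Suc)
  have rcf: "\<forall>\<^sub>F u in at_right s. f u = f s" for s
  proof (cases "0 \<le> s")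
    case True
    have "\<forall>\<^sub>F u in at_right s. u > s" by (simp add: eventually_at_right_less)
    with rc[OF True] show ?thesis
      by eventually_elim (use True in \<open>auto simp: f_def max_def\<close>)
  next
    case False
    then have "\<forall>\<^sub>F u in at_right s. u < 0"
      by (intro order_tendstoD) (auto intro: tendsto_eq_intros)
    then show ?thesis
      by eventually_elim (use False in \<open>auto simp: f_def max_def\<close>)
  qed
  have fm: "f \<in> borel_measurable lborel"
  proof (rule borel_measurable_LIMSEQ_real)
    fix s :: real
    have "filterlim (\<lambda>n. d n s) (at_right s) sequentially"
      using d_lim d_gt[THEN less_imp_neq, symmetric] d_gt by (simp add: filterlim_at)
    then have "\<forall>\<^sub>F n in sequentially. f (d n s) = f s"
      using rcf by (rule eventually_compose_filterlim[rotated])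
    then show "(\<lambda>n. f (d n s)) \<longlonglongrightarrow> f s"
      by (rule tendsto_eventually)
  next
    fix n
    have "(\<lambda>i::int. f ((of_int i + 1) / real (Suc n))) \<in> count_space UNIV \<rightarrow>\<^sub>M borel"
      by simp
    moreover have "(\<lambda>s::real. \<lfloor>real (Suc n) * s\<rfloor>) \<in> lborel \<rightarrow>\<^sub>M count_space UNIV"
      by measurable
    ultimately show "(\<lambda>s. f (d n s)) \<in> borel_measurable lborel"
      unfolding d_def by (rule measurable_compose[rotated])
  qed
  have int: "set_integrable lborel {0..T} f"
    unfolding set_integrable_def
  proof (rule integrableI_bounded_set[where A = "{0..T}" and B = 1])
    show "(\<lambda>s. indicator {0..T} s *\<^sub>R f s) \<in> borel_measurable lborel"
      using fm by simp
    show "emeasure lborel {0..T} < \<infinity>"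
      by (simp add: emeasure_lborel_Icc_eq)
  qed (auto simp: f_def indicator_def)
  obtain b where b: "b > t" "\<And>s. t < s \<Longrightarrow> s < b \<Longrightarrow> X s \<omega> = x"
    using rc[OF t(1)] xt by (auto simp: eventually_at_right_field)
  define c where "c = (t + min b T) / 2"
  have c: "t < c" "c < b" "c < T" using b(1) t(2) by (auto simp: c_def min_def field_simps)
  have one: "f s = 1" if "s \<in> {t..c}" for s
  proof (cases "s = t")
    case False
    then show ?thesis using that b(2)[of s] c t by (auto simp: f_def max_def)
  qed (use t xt in \<open>simp add: f_def\<close>)
  have "0 < c - t" using c by simp
  also have "c - t = (LBINT s:{t..c}. 1)"
    using c by (simp add: set_lebesgue_integral_def)
  also have "\<dots> = (LBINT s:{t..c}. f s)"
    using one by (intro set_lebesgue_integral_cong) auto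
  also have "\<dots> \<le> (LBINT s:{0..T}. f s)"
    unfolding set_lebesgue_integral_def
  proof (rule integral_mono)
    show "integrable lborel (\<lambda>s. indicator {t..c} s *\<^sub>R f s)"
      using set_integrable_subset[OF int, of "{t..c}"] c t by (simp add: set_integrable_def)
    show "integrable lborel (\<lambda>s. indicator {0..T} s *\<^sub>R f s)"
      using int by (simp add: set_integrable_def)
  qed (use c t in \<open>auto simp: f_def indicator_def\<close>)
  also have "\<dots> = (LBINT s:{0..T}. indicator {x} (X s \<omega>))"
    by (intro set_lebesgue_integral_cong) (auto simp: f_def max_def)
  finally show "x \<in> chain_range X T \<omega>"
    by (simp add: chain_range_def local_time_def)
qed

section \<open>Probability measures on a finite set of states\<close>

text \<open>
  A probability measure on \<open>S\<close> is represented by its probability mass function on \<open>\<Lambda>\<close>, which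
  vanishes outside \<open>S\<close>. Measurability refers to the Borel sigma-algebra inherited from the
  topology of pointwise convergence on \<open>'a \<Rightarrow> real\<close>; for finite \<open>S\<close> this is the usual one of
  the simplex in \<open>\<real>\<^sup>S\<close>.
\<close>

definition prob_measures :: "'a set \<Rightarrow> ('a \<Rightarrow> real) set" where
  "prob_measures S = {\<mu>. (\<forall>x. 0 \<le> \<mu> x) \<and> (\<forall>x. x \<notin> S \<longrightarrow> \<mu> x = 0) \<and> (\<Sum>x\<in>S. \<mu> x) = 1}"

definition prob_measures_space :: "'a set \<Rightarrow> ('a \<Rightarrow> real) measure" where
  "prob_measures_space S = restrict_space borel (prob_measures S)"

text \<open>\<open>dirichlet A S \<mu>\<close> is \<open>\<parallel>(-A)\<^sup>1\<^sup>/\<^sup>2 \<surd>\<mu>\<parallel>\<^sub>2\<^sup>2\<close> for \<open>\<mu>\<close> supported in \<open>S\<close>.\<close>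

definition dirichlet :: "('a \<Rightarrow> 'a \<Rightarrow> real) \<Rightarrow> 'a set \<Rightarrow> ('a \<Rightarrow> real) \<Rightarrow> real" where
  "dirichlet A S \<mu> = - (\<Sum>x\<in>S. \<Sum>y\<in>S. A x y * sqrt (\<mu> x) * sqrt (\<mu> y))"

definition off_diagonal :: "('a \<Rightarrow> 'a \<Rightarrow> real) \<Rightarrow> 'a \<Rightarrow> 'a \<Rightarrow> real" where
  "off_diagonal A x y = (if x = y then 0 else A x y)"

text \<open>Only meaningful for finite nonempty \<open>S\<close>.\<close>

definition eta :: "('a \<Rightarrow> 'a \<Rightarrow> real) \<Rightarrow> 'a set \<Rightarrow> real" where
  "eta A S =
     max (Max ((\<lambda>x. \<Sum>y\<in>S - {x}. \<bar>off_diagonal A x y\<bar>) ` S))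
      (max (Max ((\<lambda>y. \<Sum>x\<in>S - {y}. \<bar>off_diagonal A x y\<bar>) ` S)) 1)"

section \<open>Extended logarithm\<close>

text \<open>\<open>log 0 = -\<infinity>\<close> and \<open>log \<infinity> = \<infinity>\<close>, in contrast to \<^const>\<open>ln\<close>, where \<open>ln 0 = 0\<close>.\<close>

definition ln_ennreal :: "ennreal \<Rightarrow> ereal" where
  "ln_ennreal p = (if p = 0 then -\<infinity> else if p = \<infinity> then \<infinity> else ereal (ln (enn2real p)))"

end

theory Submission
  imports Defs
begin

text \<open>
  Write \<open>n = |S|\<close>, \<open>\<eta> = \<eta>\<^sub>S\<close>, \<open>\<ell> = \<ell>\<^sub>T\<close> and \<open>I(\<mu>) = dirichlet A S \<mu>\<close>. Both bounds follow from one
  exponential moment bound (\<open>exponential_moment_rate_le\<close>),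
  \[ E_a [ e^{T I(\ell / T)} ; R_T \subseteq S ] \le n (\eta \sqrt{8 e}\, T)^n , \]
  because the integrand \<open>e^{T F(\<ell>/T)}\<close> is at most \<open>e^{T sup (F - I)} e^{T I(\<ell>/T)}\<close>, and the
  indicator of \<open>\<ell>/T \<in> \<Gamma>\<close> is at most \<open>e^{- T inf I} e^{T I(\<ell>/T)}\<close>. The moment of the
  rate function itself involves neither \<open>\<Gamma>\<close> nor \<open>F\<close>, so a single estimate serves all of them.

  For a fixed function \<open>g\<close> on \<open>S\<close> with \<open>g \<ge> 1\<close>, let \<open>A\<^sub>S\<close> be the restriction of \<open>A\<close> to \<open>S\<close>. The operator
  \<open>A\<^sub>S\<close> plus the potential \<open>V = - (A\<^sub>S g) / g\<close> annihilates \<open>g\<close>, so by Feynman--Kac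
  (\<open>Feynman_Kac_le\<close>) the expectation of \<open>e^{\<Sum>\<^sub>x \<ell>\<^sub>x V\<^sub>x}\<close> over paths that stay in \<open>S\<close> is at most \<open>g(a)\<close>.
  Multiplying \<open>g\<close> by a constant does not change \<open>V\<close>. Formally, the choice \<open>g = \<surd>\<ell>\<close> turns the exponent
  into exactly \<open>T I(\<ell>/T)\<close>, but \<open>\<ell>\<close> is random and may vanish at states of \<open>S\<close>. Therefore
  \<open>\<surd>\<ell>\<close> is scaled so that its maximum is a natural number \<open>N\<close>, and then rounded
  up to positive integers (\<open>grid_approximation\<close>). The exponent loses at most \<open>n \<eta> T / N\<close>, the bound
  \<open>g(a)\<close> is at most \<open>N\<close>, and since one of the coordinates equals \<open>N\<close>, there are at most \<open>n N^{n-1}\<close>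
  rounded vectors (\<open>card_grid_le\<close>). Summing over all of them bounds the exponential moment by
  \[ e^{n \eta T / N} \cdot n N^{n-1} \cdot N = n \bigl( N e^{\eta T / N} \bigr)^n , \]
  and \<open>N = \<lceil>\<eta> T\<rceil>\<close> makes the bracket at most \<open>\<surd>(8 e) \<eta> T\<close> (\<open>grid_size_exists\<close>).
\<close>

section \<open>Preliminaries on right-continuous functions and the extended logarithm\<close>

text \<open>
  Evaluating at the right endpoints of the mesh intervals is what right-continuity requires: the
  right endpoint \<open>T q / n\<close> of the interval containing \<open>s\<close> tends to \<open>s\<close> from above. The sum omits the
  endpoint \<open>T\<close>, since a path that stays in a set of states during \<open>[0,T)\<close> may leave it at time \<open>T\<close>.
\<close>

lemma Riemann_sums_of_right_continuous:
  fixes f :: "real \<Rightarrow> real"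
  assumes T: "0 < T" and bnd: "\<And>s. \<bar>f s\<bar> \<le> 1"
    and rc: "\<And>t. 0 \<le> t \<Longrightarrow> \<forall>\<^sub>F s in at_right t. f s = f t"
  shows "(\<lambda>n. \<Sum>k\<in>{1..<n}. T / real n * f (T / real n * real k)) \<longlonglongrightarrow> (LBINT s:{0..T}. f s)"
proof -
  define I where "I n k = {T / real n * (real k - 1)..<T / real n * real k}" for n k :: nat
  \<comment> \<open>The index of the mesh interval that contains \<open>s\<close>.\<close>
  define q where "q n s = Suc (nat \<lfloor>real n * s / T\<rfloor>)" for n s
  define F where "F n s = (\<Sum>k\<in>{1..<n}. indicator (I n k) s * f (T / real n * real k))" for n s
  have mem: "s \<in> I n k \<longleftrightarrow> 0 \<le> s \<and> k = q n s" if "k \<in> {1..<n}" for n k s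
  proof -
    have n: "0 < real n" and k: "1 \<le> k" using that by auto
    have "s \<in> I n k \<longleftrightarrow> real k - 1 \<le> real n * s / T \<and> real n * s / T < real k"
      using n T unfolding I_def by (auto simp: field_simps)
    also have "\<dots> \<longleftrightarrow> \<lfloor>real n * s / T\<rfloor> = int k - 1"
      by (auto simp: floor_eq_iff)
    also have "\<dots> \<longleftrightarrow> 0 \<le> s \<and> k = q n s"
    proof -
      have "0 \<le> s \<longleftrightarrow> 0 \<le> \<lfloor>real n * s / T\<rfloor>"
        using n T by (auto simp: zero_le_divide_iff zero_le_mult_iff)
      then show ?thesis using k unfolding q_def by (auto simp del: zero_le_floor)
    qed
    finally show ?thesis .
  qed
  have F_eq: "F n s = (if 0 \<le> s \<and> q n s < n then f (T / real n * real (q n s)) else 0)" for n s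
  proof -
    have "F n s = (\<Sum>k\<in>{1..<n}. if k = q n s then (if 0 \<le> s then f (T / real n * real (q n s)) else 0) else 0)"
      unfolding F_def by (intro sum.cong) (auto simp: mem indicator_def simp del: atLeastLessThan_iff)
    then show ?thesis by (auto simp: q_def)
  qed
  have q_gt: "s < T / real n * real (q n s)" if "0 < n" "0 \<le> s" for n s
  proof -
    have "real n * s / T < real (q n s)"
      unfolding q_def using that T by (simp add: le_floor_iff) linarith
    then show ?thesis using that T by (simp add: field_simps)
  qed
  have q_le: "T / real n * real (q n s) \<le> s + T / real n" if "0 < n" "0 \<le> s" for n s
  proof -
    have "real (q n s) \<le> real n * s / T + 1"
      unfolding q_def using that T by (simp add: le_floor_iff)
    then show ?thesis using that T by (simp add: field_simps)
  qed
  have h0: "(\<lambda>n. T / real n) \<longlonglongrightarrow> 0"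
    by (rule lim_const_over_n)
  have lim: "(\<lambda>n. F n s) \<longlonglongrightarrow> indicator {0..<T} s * f s" for s
  proof (cases "0 \<le> s \<and> s < T")
    case False
    have "F n s = 0" for n
    proof (cases "0 \<le> s \<and> 0 < n")
      case True
      have "T < T / real n * real (q n s)" using False True q_gt[of n s] by auto
      then have "\<not> q n s < n" using True T by (auto simp: field_simps)
      then show ?thesis by (simp add: F_eq)
    qed (auto simp: F_eq)
    then show ?thesis using False by auto
  next
    case True
    have pos: "\<forall>\<^sub>F n in sequentially. 0 < n" by (rule eventually_gt_at_top)
    have "(\<lambda>n. T / real n * real (q n s)) \<longlonglongrightarrow> s"
    proof (rule tendsto_sandwich[where f = "\<lambda>_. s" and h = "\<lambda>n. s + T / real n"])
      show "(\<lambda>n. s + T / real n) \<longlonglongrightarrow> s" using tendsto_add[OF tendsto_const h0] by simp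
      show "\<forall>\<^sub>F n in sequentially. s \<le> T / real n * real (q n s)"
        using pos by eventually_elim (use True q_gt in \<open>auto intro: less_imp_le\<close>)
      show "\<forall>\<^sub>F n in sequentially. T / real n * real (q n s) \<le> s + T / real n"
        using pos by eventually_elim (use True q_le in auto)
    qed simp
    moreover have "\<forall>\<^sub>F n in sequentially. T / real n * real (q n s) \<in> {s<..} \<and> T / real n * real (q n s) \<noteq> s"
      using pos
    proof eventually_elim
      case (elim n)
      then show ?case using q_gt[of n s] True by simp
    qed
    ultimately have "filterlim (\<lambda>n. T / real n * real (q n s)) (at_right s) sequentially"
      unfolding filterlim_at by blast
    then have "\<forall>\<^sub>F n in sequentially. f (T / real n * real (q n s)) = f s"
      using rc[of s] True by (auto elim: eventually_compose_filterlim[rotated])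
    moreover have "\<forall>\<^sub>F n in sequentially. T / real n < T - s"
      using order_tendstoD(2)[OF h0, of "T - s"] True by simp
    ultimately have "\<forall>\<^sub>F n in sequentially. F n s = f s"
      using pos
    proof eventually_elim
      case (elim n)
      have "T / real n * real (q n s) < T" using q_le[of n s] elim True by auto
      then have "q n s < n" using elim T by (auto simp: field_simps)
      then show ?case using elim True by (simp add: F_eq)
    qed
    then show ?thesis using True by (simp add: tendsto_eventually)
  qed
  have Fm: "F n \<in> borel_measurable lborel" for n
    unfolding F_def I_def by measurable
  \<comment> \<open>Measurability of \<open>f\<close> is itself a consequence of the pointwise limit.\<close>
  have fm: "(\<lambda>s. indicator {0..<T} s * f s) \<in> borel_measurable lborel"
    by (rule borel_measurable_LIMSEQ_real[OF lim Fm])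
  have int_F: "integral\<^sup>L lborel (F n) = (\<Sum>k\<in>{1..<n}. T / real n * f (T / real n * real k))" for n
  proof -
    have "bounded (I n k)" for k
      unfolding I_def
      by (rule bounded_subset[OF bounded_cbox[of "T / real n * (real k - 1)" "T / real n * real k"]]) auto
    then have "integrable lborel (indicator (I n k) :: real \<Rightarrow> real)" for k
      by (intro integrable_real_indicator emeasure_bounded_finite) (auto simp: I_def)
    then have "integral\<^sup>L lborel (F n) = (\<Sum>k\<in>{1..<n}. measure lborel (I n k) * f (T / real n * real k))"
      unfolding F_def by (subst Bochner_Integration.integral_sum) auto
    also have "\<dots> = (\<Sum>k\<in>{1..<n}. T / real n * f (T / real n * real k))"
    proof (intro sum.cong refl)
      fix k assume "k \<in> {1..<n}"
      then have "measure lborel (I n k) = T / real n"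
        unfolding I_def using T by (subst measure_lborel_Ico) (auto simp: field_simps)
      then show "measure lborel (I n k) * f (T / real n * real k) = T / real n * f (T / real n * real k)"
        by simp
    qed
    finally show ?thesis .
  qed
  have "(\<lambda>n. integral\<^sup>L lborel (F n)) \<longlonglongrightarrow> (\<integral>s. indicator {0..<T} s * f s \<partial>lborel)"
  proof (rule integral_dominated_convergence[where w = "indicator {0..T}"])
    show "AE s in lborel. norm (F n s) \<le> indicator {0..T} s" for n
    proof (rule AE_I2)
      fix s
      have "s \<le> T" if "0 \<le> s" "q n s < n"
      proof -
        have "s < T / real n * real (q n s)" using q_gt[of n s] that by auto
        also have "\<dots> \<le> T / real n * real n" using that T by (intro mult_left_mono) auto
        finally show ?thesis using that by auto
      qed
      then show "norm (F n s) \<le> indicator {0..T} s"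
        using bnd by (auto simp: F_eq)
    qed
    show "integrable lborel (indicator {0..T} :: real \<Rightarrow> real)"
      by (intro integrable_real_indicator emeasure_bounded_finite) auto
  qed (use fm Fm lim in auto)
  also have "(\<integral>s. indicator {0..<T} s * f s \<partial>lborel) = (LBINT s:{0..T}. f s)"
    unfolding set_lebesgue_integral_def
  proof (rule integral_cong_AE)
    have "(\<lambda>s. indicator {0..T} s *\<^sub>R f s) = (\<lambda>s. indicator {0..<T} s * f s + indicator {T} s * f T)"
      by (rule ext) (auto simp: indicator_def of_bool_def less_imp_le[OF T])
    then show "(\<lambda>s. indicator {0..T} s *\<^sub>R f s) \<in> borel_measurable lborel"
      using fm by simp
    show "AE s in lborel. indicator {0..<T} s * f s = indicator {0..T} s *\<^sub>R f s"
      using AE_lborel_singleton[of T] by (auto elim!: eventually_mono simp: indicator_def)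
  qed (rule fm)
  finally show ?thesis by (simp add: int_F)
qed

lemma ln_ennreal_le:
  assumes "p \<le> ennreal (exp r)"
  shows "ln_ennreal p \<le> ereal r"
proof (cases "p = 0")
  case False
  have fin: "p < \<infinity>" using assms by (simp add: le_less_trans)
  have "0 < enn2real p" using False fin by (simp add: enn2real_positive_iff zero_less_iff_neq_zero)
  moreover have "enn2real p \<le> exp r" using assms by (simp add: enn2real_leI)
  ultimately have "ln (enn2real p) \<le> r" using ln_le_cancel_iff[of "enn2real p" "exp r"] by simp
  then show ?thesis using False fin by (simp add: ln_ennreal_def)
qed (simp add: ln_ennreal_def)


section \<open>Rounding to an integer grid\<close>

text \<open>
  The union over the position \<open>z\<close> of a maximal coordinate makes the count \<open>|S| N^{|S|-1}\<close> immediate.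
\<close>

definition grid :: "'a set \<Rightarrow> nat \<Rightarrow> ('a \<Rightarrow> nat) set" where
  "grid S N = (\<Union>z\<in>S. PiE S (\<lambda>x. if x = z then {N} else {1..N}))"

lemma grid_bounds:
  assumes "g \<in> grid S N" "1 \<le> N" "x \<in> S"
  shows "1 \<le> g x" "g x \<le> N"
  using assms by (auto simp: grid_def PiE_iff split: if_splits)

lemma finite_grid: "finite S \<Longrightarrow> finite (grid S N)"
  unfolding grid_def by (auto intro!: finite_PiE)

lemma card_grid_le:
  assumes "finite S"
  shows "card (grid S N) \<le> card S * N ^ (card S - 1)"
proof -
  have "card (grid S N) \<le> (\<Sum>z\<in>S. card (PiE S (\<lambda>x. if x = z then {N} else {1..N})))"
    unfolding grid_def by (rule card_UN_le[OF assms])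
  also have "\<dots> = (\<Sum>z\<in>S. N ^ (card S - 1))"
  proof (rule sum.cong[OF refl])
    fix z assume z: "z \<in> S"
    have "card (PiE S (\<lambda>x. if x = z then {N} else {1..N})) = (\<Prod>x\<in>S. if x = z then 1 else N)"
      unfolding card_PiE[OF assms] by (intro prod.cong) auto
    also have "\<dots> = N ^ (card S - 1)"
      using assms z by (subst prod.remove[OF assms z]) (simp add: card_Diff_singleton)
    finally show "card (PiE S (\<lambda>x. if x = z then {N} else {1..N})) = N ^ (card S - 1)" .
  qed
  finally show ?thesis by simp
qed

text \<open>
  With \<open>M = max l\<close> and \<open>\<surd>l = c u\<close>, \<open>c = \<surd>M / N\<close>, the largest coordinate of \<open>u\<close> is \<open>N\<close>; take \<open>g\<close> to be \<open>u\<close>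
  rounded up, and at least \<open>1\<close>. The diagonal of \<open>A\<close> contributes equally to both sides. An off-diagonal
  pair contributes \<open>A x y\<close> times
  \[ c^2 ( u_x^2 g_y / g_x - u_x u_y ) \le c^2 u_x (g_y - u_y) \le c^2 u_x \le c^2 N = M / N \le T / N , \]
  where \<open>u \<le> g\<close> absorbs the quotient, so that small values of \<open>g\<close> in the denominator do no harm.
\<close>

lemma grid_approximation:
  fixes A :: "'a \<Rightarrow> 'a \<Rightarrow> real" and l :: "'a \<Rightarrow> real"
  assumes S: "finite S" and N: "1 \<le> N"
    and A: "\<And>x y. x \<noteq> y \<Longrightarrow> 0 \<le> A x y"
    and \<eta>: "\<And>x. x \<in> S \<Longrightarrow> (\<Sum>y\<in>S - {x}. A x y) \<le> \<eta>" and \<eta>0: "0 \<le> \<eta>"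
    and l: "\<And>x. 0 \<le> l x" and T: "(\<Sum>x\<in>S. l x) = T" "0 < T"
  obtains g where "g \<in> grid S N"
    and "- (\<Sum>x\<in>S. \<Sum>y\<in>S. A x y * sqrt (l x) * sqrt (l y)) \<le>
      - (\<Sum>x\<in>S. l x * ((\<Sum>y\<in>S. A x y * real (g y)) / real (g x))) + real (card S) * (\<eta> * T / real N)"
proof -
  have ne: "S \<noteq> {}" using T by auto
  define M where "M = Max (l ` S)"
  have l_le: "l x \<le> M" if "x \<in> S" for x
    unfolding M_def using S that by simp
  have "M \<in> l ` S" unfolding M_def using S ne by (intro Max_in) auto
  then obtain z where z: "z \<in> S" "l z = M" by (metis imageE)
  have M_le: "M \<le> T"
    using member_le_sum[of z S l] S z l T by auto
  have M: "0 < M"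
  proof (rule ccontr)
    assume "\<not> 0 < M"
    then have "(\<Sum>x\<in>S. l x) \<le> 0" using l_le by (intro sum_nonpos) force
    then show False using T by simp
  qed
  define c where "c = sqrt M / real N"
  define u where "u x = sqrt (l x) / c" for x
  define g where "g = (\<lambda>x\<in>S. max 1 (nat \<lceil>u x\<rceil>))"
  have c: "0 < c" using M N by (simp add: c_def)
  have cc: "c * c = M / (real N * real N)" using M by (simp add: c_def)
  have u0: "0 \<le> u x" for x using c l by (simp add: u_def)
  have uN: "u x \<le> real N" if "x \<in> S" for x
    using c M N l_le[OF that] by (simp add: u_def c_def field_simps)
  have uz: "u z = real N" using z M N by (simp add: u_def c_def)
  have sq: "sqrt (l x) = c * u x" for x using c by (simp add: u_def)
  have lu: "l x = c * c * (u x * u x)" for x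
    using real_sqrt_mult_self[of "l x"] l[of x] unfolding sq by (simp add: mult_ac)
  have ug: "u x \<le> real (g x)" if "x \<in> S" for x
    using that u0[of x] by (simp add: g_def) linarith
  have gu: "real (g x) - u x \<le> 1" if "x \<in> S" for x
    using that u0[of x] by (simp add: g_def max_def) linarith
  have g1: "1 \<le> g x" if "x \<in> S" for x using that by (simp add: g_def)
  have "g x \<le> N" if "x \<in> S" for x
    using that uN[OF that] N by (simp add: g_def ceiling_le_iff nat_le_iff)
  moreover have "g z = N" using z uz N by (simp add: g_def)
  moreover have "g \<in> extensional S" by (simp add: g_def)
  ultimately have "g \<in> grid S N"
    unfolding grid_def using z g1 by (intro UN_I[of z]) (auto simp: PiE_iff)
  moreover have "(\<Sum>x\<in>S. l x * ((\<Sum>y\<in>S. A x y * real (g y)) / real (g x)))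
      - (\<Sum>x\<in>S. \<Sum>y\<in>S. A x y * sqrt (l x) * sqrt (l y)) \<le> real (card S) * (\<eta> * T / real N)"
  proof -
    have "(\<Sum>x\<in>S. l x * ((\<Sum>y\<in>S. A x y * real (g y)) / real (g x)))
      - (\<Sum>x\<in>S. \<Sum>y\<in>S. A x y * sqrt (l x) * sqrt (l y))
      = (\<Sum>x\<in>S. \<Sum>y\<in>S. A x y * (l x * real (g y) / real (g x) - sqrt (l x) * sqrt (l y)))"
      by (simp add: sum_subtractf[symmetric] sum_distrib_left sum_divide_distrib algebra_simps)
    also have "\<dots> \<le> (\<Sum>x\<in>S. \<eta> * T / real N)"
    proof (rule sum_mono)
      fix x assume x: "x \<in> S"
      have "(\<Sum>y\<in>S. A x y * (l x * real (g y) / real (g x) - sqrt (l x) * sqrt (l y)))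
        = (\<Sum>y\<in>S - {x}. A x y * (l x * real (g y) / real (g x) - sqrt (l x) * sqrt (l y)))"
        using g1[OF x] l[of x] by (subst sum.remove[OF S x]) simp
      also have "\<dots> \<le> (\<Sum>y\<in>S - {x}. A x y * (c * c * u x))"
      proof (intro sum_mono mult_left_mono A)
        fix y assume y: "y \<in> S - {x}"
        have "u x / real (g x) \<le> 1" using ug[OF x] g1[OF x] by simp
        then have "u x * (u x / real (g x)) * real (g y) \<le> u x * 1 * real (g y)"
          using u0[of x] by (intro mult_right_mono mult_left_mono) auto
        then have "u x * u x * real (g y) / real (g x) - u x * u y \<le> u x * (real (g y) - u y)"
          by (simp add: algebra_simps)
        also have "\<dots> \<le> u x * 1"
          using gu[of y] y u0[of x] by (intro mult_left_mono) auto
        finally have "c * c * (u x * u x * real (g y) / real (g x) - u x * u y) \<le> c * c * u x"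
          using c by simp
        then show "l x * real (g y) / real (g x) - sqrt (l x) * sqrt (l y) \<le> c * c * u x"
          unfolding sq unfolding lu by (simp add: algebra_simps)
      qed auto
      also have "\<dots> = (\<Sum>y\<in>S - {x}. A x y) * (c * c * u x)"
        by (simp add: sum_distrib_right)
      also have "\<dots> \<le> \<eta> * (c * c * real N)"
        using \<eta>[OF x] uN[OF x] u0[of x] \<eta>0 c by (intro mult_mono) auto
      also have "\<dots> = \<eta> * (M / real N)"
        using N by (simp add: cc)
      also have "\<dots> \<le> \<eta> * T / real N"
        using M_le \<eta>0 by (simp add: divide_right_mono mult_left_mono)
      finally show "(\<Sum>y\<in>S. A x y * (l x * real (g y) / real (g x) - sqrt (l x) * sqrt (l y)))
        \<le> \<eta> * T / real N" .
    qed
    finally show ?thesis by simp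
  qed
  ultimately show ?thesis by (intro that[of g]) auto
qed

text \<open>
  For \<open>N = \<lceil>K\<rceil>\<close> the ratio \<open>t = K / N\<close> lies in \<open>[1/2, 1]\<close>, and there the convex function \<open>e^t\<close> stays below
  the line \<open>2 \<surd>e t\<close>, which it meets at \<open>t = 1/2\<close>; moreover \<open>2 \<surd>e \<le> \<surd>(8 e)\<close>.
\<close>

lemma grid_size_exists:
  fixes K :: real
  assumes K: "1 \<le> K"
  obtains N :: nat where "1 \<le> N" "real N * exp (K / real N) \<le> sqrt (8 * exp 1) * K"
proof -
  define N where "N = nat \<lceil>K\<rceil>"
  define t where "t = K / real N"
  have N: "K \<le> real N" "real N \<le> 2 * K" "1 \<le> N"
    using K unfolding N_def by linarith+
  have t: "1 / 2 \<le> t" "t \<le> 1"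
    using N K by (auto simp: t_def field_simps)
  have "exp (t - 1 / 2) \<le> 1 + (t - 1 / 2) + (t - 1 / 2)\<^sup>2"
    using t by (intro exp_bound) auto
  also have "(t - 1 / 2)\<^sup>2 \<le> t - 1 / 2"
    using t by (simp add: power2_eq_square mult_left_le)
  finally have "exp (t - 1 / 2) \<le> 2 * t" by simp
  then have "exp (1 / 2) * exp (t - 1 / 2) \<le> exp (1 / 2) * (2 * t)"
    by (intro mult_left_mono) auto
  then have "exp t \<le> 2 * exp (1 / 2) * t" by (simp flip: exp_add)
  also have "2 * exp (1 / 2) \<le> sqrt (8 * exp 1 :: real)"
    by (intro real_le_rsqrt) (simp add: power_mult_distrib flip: exp_double)
  finally have "exp t \<le> sqrt (8 * exp 1) * t" using t by (simp add: mult_right_mono)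
  then have "real N * exp t \<le> real N * (sqrt (8 * exp 1) * t)" by (intro mult_left_mono) auto
  then show ?thesis using N(3) by (intro that[of N]) (auto simp: t_def)
qed

context markov_chain_with_generator
begin

section \<open>Finite-dimensional distributions\<close>

definition transition :: "real \<Rightarrow> 'a \<Rightarrow> 'a \<Rightarrow> real" where
  "transition t x y = measure (P x) {\<omega> \<in> space (P x). X t \<omega> = y}"

lemma transition_0: "transition 0 x y = (if x = y then 1 else 0)"
proof -
  interpret prob_space "P x" by (rule prob_space)
  have [measurable]: "X 0 \<in> P x \<rightarrow>\<^sub>M count_space UNIV" by (rule measurable_X) simp
  have s: "{\<omega> \<in> space (P x). X 0 \<omega> = y} \<in> events" by measurable
  show ?thesis
  proof (cases "x = y")
    case True
    then have "prob {\<omega> \<in> space (P x). X 0 \<omega> = y} = 1"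
      using initial[of x] by (subst prob_Collect_eq_1[OF s]) auto
    then show ?thesis using True by (simp add: transition_def)
  next
    case False
    then have "prob {\<omega> \<in> space (P x). X 0 \<omega> = y} = 0"
      using initial[of x] by (subst prob_Collect_eq_0[OF s]) (auto elim: eventually_mono)
    then show ?thesis using False by (simp add: transition_def)
  qed
qed

text \<open>
  The list holds the states at the times \<open>h, 2 h, \<dots>\<close>, the latest one first. In this order the Markov
  property at the latest time peels off the head of the list.
\<close>

primrec cylinder :: "'a \<Rightarrow> real \<Rightarrow> 'a list \<Rightarrow> 'w set" where
  "cylinder a h [] = space (P a)"
| "cylinder a h (y # ys) = {\<omega> \<in> cylinder a h ys. X (h * real (Suc (length ys))) \<omega> = y}"

lemma cylinder_in_history:
  assumes "0 \<le> h"
  shows "cylinder a h ys \<in> sigma_sets (space (P a))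
    {X u -` {z} \<inter> space (P a) | u z. 0 \<le> u \<and> u \<le> h * real (length ys)}"
proof (induction ys)
  case (Cons y ys)
  define H where "H t = {X u -` {z} \<inter> space (P a) | u z. 0 \<le> u \<and> u \<le> t}" for t
  interpret sigma_algebra "space (P a)" "sigma_sets (space (P a)) (H t)" for t
    by (rule sigma_algebra_sigma_sets) (auto simp: H_def)
  have "H (h * real (length ys)) \<subseteq> H (h * real (Suc (length ys)))"
    proof -
    have "h * real (length ys) \<le> h * real (Suc (length ys))"
      using assms by (intro mult_left_mono) auto
    then show ?thesis unfolding H_def by (blast intro: order_trans)
  qed
  then have "cylinder a h ys \<in> sigma_sets (space (P a)) (H (h * real (Suc (length ys))))"
    using Cons.IH unfolding H_def[symmetric] by (meson sigma_sets_mono' subsetD)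
  moreover have "X (h * real (Suc (length ys))) -` {y} \<inter> space (P a)
      \<in> sigma_sets (space (P a)) (H (h * real (Suc (length ys))))"
    unfolding H_def using assms
    by (intro sigma_sets.Basic CollectI exI[of _ "h * real (Suc (length ys))"] exI[of _ y] conjI)
      (simp_all del: of_nat_Suc)
  ultimately have "cylinder a h ys \<inter> (X (h * real (Suc (length ys))) -` {y} \<inter> space (P a))
      \<in> sigma_sets (space (P a)) (H (h * real (Suc (length ys))))"
    by (rule Int)
  moreover have "cylinder a h ys \<subseteq> space (P a)"
    by (induction ys) auto
  then have "cylinder a h ys \<inter> (X (h * real (Suc (length ys))) -` {y} \<inter> space (P a))
      = cylinder a h (y # ys)"
    by auto
  ultimately have "cylinder a h (y # ys)
      \<in> sigma_sets (space (P a)) (H (h * real (Suc (length ys))))"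
    by (simp only:)
  then show ?case unfolding H_def length_Cons .
qed (simp add: sigma_sets_top)

lemma cylinder_sets: "0 \<le> h \<Longrightarrow> cylinder a h ys \<in> sets (P a)"
proof (induction ys)
  case (Cons y ys)
  have [measurable]: "X (h * real (Suc (length ys))) \<in> P a \<rightarrow>\<^sub>M count_space UNIV"
    using Cons.prems by (intro measurable_X) simp
  have [measurable]: "cylinder a h ys \<in> sets (P a)" by (rule Cons.IH[OF Cons.prems])
  have "cylinder a h (y # ys) =
      cylinder a h ys \<inter> {\<omega> \<in> space (P a). X (h * real (Suc (length ys))) \<omega> = y}"
    using sets.sets_into_space[OF \<open>cylinder a h ys \<in> sets (P a)\<close>] by auto
  also have "\<dots> \<in> sets (P a)" by measurable
  finally show ?case .
qed simp

text \<open>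
  Appending the starting point \<open>a\<close> makes \<open>hd\<close> the current state for the empty list as well.
\<close>

lemma measure_cylinder_Cons:
  assumes "0 \<le> h"
  shows "measure (P a) (cylinder a h (y # ys)) =
    measure (P a) (cylinder a h ys) * transition h (hd (ys @ [a])) y"
proof (cases ys)
  case Nil
  interpret prob_space "P a" by (rule prob_space)
  show ?thesis using Nil by (simp add: transition_def prob_space)
next
  case (Cons x xs)
  let ?s = "h * real (length ys)"
  have "cylinder a h (y # ys) = {\<omega> \<in> cylinder a h ys. X ?s \<omega> = x \<and> X (?s + h) \<omega> = y}"
    by (auto simp: Cons algebra_simps)
  moreover have "cylinder a h ys = {\<omega> \<in> cylinder a h ys. X ?s \<omega> = x}"
    by (auto simp: Cons)
  ultimately show ?thesis
    using markov[OF _ assms cylinder_in_history[OF assms, of a ys], of x y] assms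
    by (simp add: Cons transition_def)
qed

text \<open>
  The left-hand side is the expectation of \<open>w(X\<^sub>h) \<cdots> w(X\<^sub>n\<^sub>h) g(X\<^sub>n\<^sub>h)\<close> over paths that are in \<open>S\<close> at all
  of these times, that is, the \<open>n\<close>-th power of a nonnegative matrix applied to \<open>g\<close>. If \<open>g\<close> is
  superharmonic for this matrix up to the factor \<open>c\<close>, each step costs at most that factor.
\<close>

lemma cylinder_sum_le:
  fixes w g :: "'a \<Rightarrow> real"
  assumes S: "finite S" and a: "a \<in> S" and h: "0 \<le> h" and w: "\<And>x. 0 \<le> w x" and c: "0 \<le> c"
    and step: "\<And>x. x \<in> S \<Longrightarrow> (\<Sum>y\<in>S. transition h x y * (w y * g y)) \<le> c * g x"
  shows "(\<Sum>ys\<in>{ys. set ys \<subseteq> S \<and> length ys = n}.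
      measure (P a) (cylinder a h ys) * prod_list (map w ys) * g (hd (ys @ [a]))) \<le> c ^ n * g a"
proof (induction n)
  case 0
  interpret prob_space "P a" by (rule prob_space)
  have "{ys. set ys \<subseteq> S \<and> length ys = 0} = {[]}" by auto
  then show ?case by (simp add: prob_space)
next
  case (Suc n)
  define L where "L n = {ys. set ys \<subseteq> S \<and> length ys = n}" for n
  define m where "m ys = measure (P a) (cylinder a h ys) * prod_list (map w ys)" for ys
  have m0: "0 \<le> m ys" for ys
    unfolding m_def by (intro mult_nonneg_nonneg prod_list_nonneg) (auto simp: w)
  have L: "L (Suc n) = (\<lambda>(ys, y). y # ys) ` (L n \<times> S)"
  proof (intro equalityI subsetI)
    fix xs assume "xs \<in> L (Suc n)"
    moreover from this obtain y ys where "xs = y # ys" by (cases xs) (auto simp: L_def)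
    ultimately show "xs \<in> (\<lambda>(ys, y). y # ys) ` (L n \<times> S)"
      by (intro image_eqI[of _ _ "(ys, y)"]) (auto simp: L_def)
  qed (auto simp: L_def)
  have inj: "inj_on (\<lambda>(ys, y). y # ys) (L n \<times> S)"
    by (auto simp: inj_on_def)
  have "(\<Sum>ys\<in>L (Suc n). m ys * g (hd (ys @ [a]))) = (\<Sum>ys\<in>L n. \<Sum>y\<in>S. m (y # ys) * g y)"
    unfolding L by (subst sum.reindex[OF inj]) (simp add: sum.cartesian_product case_prod_beta)
  also have "\<dots> = (\<Sum>ys\<in>L n. m ys * (\<Sum>y\<in>S. transition h (hd (ys @ [a])) y * (w y * g y)))"
    by (simp add: m_def measure_cylinder_Cons[OF h] sum_distrib_left mult_ac
        del: cylinder.simps)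
  also have "\<dots> \<le> (\<Sum>ys\<in>L n. m ys * (c * g (hd (ys @ [a]))))"
  proof (intro sum_mono mult_left_mono m0 step)
    fix ys assume "ys \<in> L n"
    then show "hd (ys @ [a]) \<in> S" using a by (cases ys) (auto simp: L_def)
  qed
  also have "\<dots> = c * (\<Sum>ys\<in>L n. m ys * g (hd (ys @ [a])))"
    by (simp add: sum_distrib_left mult_ac)
  also have "\<dots> \<le> c * (c ^ n * g a)"
    using Suc.IH c by (intro mult_left_mono) (auto simp: L_def m_def)
  finally show ?case by (simp add: L_def m_def mult_ac)
qed

text \<open>
  At \<open>h = 0\<close> the sum has value \<open>g x\<close> and derivative \<open>(A\<^sub>S g)(x) + V x g x = 0\<close>, so it exceeds
  \<open>g x\<close> by \<open>o(h)\<close> only; \<open>g \<ge> 1\<close> converts the additive error \<open>e h\<close> into a factor.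
\<close>

lemma transition_step_le:
  fixes V g :: "'a \<Rightarrow> real"
  assumes S: "finite S" and g: "\<And>x. x \<in> S \<Longrightarrow> 1 \<le> g x"
    and V: "\<And>x. x \<in> S \<Longrightarrow> V x * g x = - (\<Sum>y\<in>S. A x y * g y)" and e: "0 < e"
  shows "\<forall>\<^sub>F h in at_right 0. \<forall>x\<in>S.
    (\<Sum>y\<in>S. transition h x y * (exp (h * V y) * g y)) \<le> (1 + e * h) * g x"
proof (intro eventually_ball_finite ballI S)
  fix x assume x: "x \<in> S"
  define \<phi> where "\<phi> h = (\<Sum>y\<in>S. transition h x y * (exp (h * V y) * g y))" for h
  have tr: "((\<lambda>h. transition h x y) has_real_derivative A x y) (at 0 within {0..})" for y
    unfolding transition_def by (rule generator)
  have "(\<phi> has_real_derivative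
      (\<Sum>y\<in>S. A x y * (exp (0 * V y) * g y) + transition 0 x y * (V y * g y))) (at 0 within {0..})"
    unfolding \<phi>_def by (auto intro!: derivative_eq_intros tr sum.cong simp: algebra_simps)
  also have "(\<Sum>y\<in>S. A x y * (exp (0 * V y) * g y) + transition 0 x y * (V y * g y)) = 0"
  proof -
    have "(\<Sum>y\<in>S. transition 0 x y * (V y * g y)) = V x * g x"
      using S x by (simp add: transition_0 if_distrib if_distribR cong: if_cong)
    then show ?thesis using V[OF x] by (simp add: sum.distrib)
  qed
  finally have "((\<lambda>h. (\<phi> h - \<phi> 0) / (h - 0)) \<longlongrightarrow> 0) (at 0 within {0..})"
    unfolding has_field_derivative_iff .
  then have "((\<lambda>h. (\<phi> h - \<phi> 0) / h) \<longlongrightarrow> 0) (at_right 0)"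
    unfolding diff_zero by (rule tendsto_within_subset) auto
  then have "\<forall>\<^sub>F h in at_right 0. (\<phi> h - \<phi> 0) / h < e"
    using e by (rule order_tendstoD(2))
  moreover have "\<forall>\<^sub>F h in at_right 0. (0::real) < h" by (rule eventually_at_right_less)
  ultimately show "\<forall>\<^sub>F h in at_right 0. \<phi> h \<le> (1 + e * h) * g x"
  proof eventually_elim
    case (elim h)
    have "\<phi> 0 = g x"
      using S x by (simp add: \<phi>_def transition_0 if_distrib if_distribR cong: if_cong)
    then have "\<phi> h \<le> g x + e * h * 1" using elim by (simp add: field_simps)
    also have "\<dots> \<le> g x + e * h * g x"
      using elim e g[OF x] by (intro add_left_mono mult_left_mono) auto
    finally show ?case by (simp add: algebra_simps)
  qed
qed

section \<open>Local times as limits of visit counts\<close>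

lemma local_time_Riemann:
  assumes "\<omega> \<in> space (P a)" "0 < T"
  shows "(\<lambda>n. \<Sum>k\<in>{1..<n}. T / real n * indicator {x} (X (T / real n * real k) \<omega>))
    \<longlonglongrightarrow> local_time X T \<omega> x"
  unfolding local_time_def
proof (rule Riemann_sums_of_right_continuous[OF assms(2)])
  fix t :: real assume "0 \<le> t"
  from right_continuous[OF assms(1) this]
  show "\<forall>\<^sub>F s in at_right t. (indicator {x} (X s \<omega>) :: real) = indicator {x} (X t \<omega>)"
    by (auto elim: eventually_mono)
qed (simp add: indicator_def)

lemma local_time_measurable:
  assumes "0 < T"
  shows "(\<lambda>\<omega>. local_time X T \<omega> x) \<in> borel_measurable (P a)"
proof (rule borel_measurable_LIMSEQ_real)
  show "(\<lambda>\<omega>. \<Sum>k\<in>{1..<n}. T / real n * indicator {x} (X (T / real n * real k) \<omega>))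
      \<in> borel_measurable (P a)" for n
  proof (intro borel_measurable_sum)
    fix k
    have "X (T / real n * real k) \<in> P a \<rightarrow>\<^sub>M count_space UNIV"
      using assms by (intro measurable_X) simp
    then show "(\<lambda>\<omega>. T / real n * indicator {x} (X (T / real n * real k) \<omega>)) \<in> borel_measurable (P a)"
      by measurable
  qed
qed (rule local_time_Riemann[OF _ assms])

lemma chain_range_measurable:
  assumes "0 < T"
  shows "{\<omega> \<in> space (P a). chain_range X T \<omega> \<subseteq> S} \<in> sets (P a)"
proof -
  have [measurable]: "(\<lambda>\<omega>. local_time X T \<omega> x) \<in> borel_measurable (P a)" for x
    by (rule local_time_measurable[OF assms])
  have "{\<omega> \<in> space (P a). chain_range X T \<omega> \<subseteq> S} =
      {\<omega> \<in> space (P a). \<forall>x. x \<in> S \<or> local_time X T \<omega> x = 0}"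
    by (auto simp: chain_range_def)
  also have "\<dots> \<in> sets (P a)" by measurable
  finally show ?thesis .
qed

lemma visits_in_range:
  assumes "\<omega> \<in> space (P a)" "chain_range X T \<omega> \<subseteq> S" "0 < T" "k < n"
  shows "X (T / real n * real k) \<omega> \<in> S"
proof -
  have "T / real n * real k < T" using assms by (simp add: field_simps)
  then have "X (T / real n * real k) \<omega> \<in> (\<lambda>s. X s \<omega>) ` {0..<T}" using assms(3) by auto
  then show ?thesis
    using chain_range_eq[of X \<omega> T, OF right_continuous[OF assms(1)]] assms(2) by auto
qed

text \<open>
  At each of the \<open>n - 1\<close> mesh points exactly one state of \<open>S\<close> is counted, with weight \<open>T / n\<close>. The
  approximate local times therefore add up to \<open>T (n - 1) / n\<close>, which tends to \<open>T\<close>.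
\<close>

lemma occupation_prob_measures:
  assumes \<omega>: "\<omega> \<in> space (P a)" and R: "chain_range X T \<omega> \<subseteq> S" and T: "0 < T" and S: "finite S"
  shows "occupation X T \<omega> \<in> prob_measures S"
proof -
  have lim: "(\<lambda>n. \<Sum>k\<in>{1..<n}. T / real n * indicator {x} (X (T / real n * real k) \<omega>))
    \<longlonglongrightarrow> local_time X T \<omega> x" for x
    by (rule local_time_Riemann[OF \<omega> T])
  have "0 \<le> local_time X T \<omega> x" for x
    by (rule tendsto_lowerbound[OF lim]) (use T in \<open>auto intro!: sum_nonneg always_eventually\<close>)
  moreover have "local_time X T \<omega> x = 0" if "x \<notin> S" for x
    using R that by (auto simp: chain_range_def)
  moreover have "(\<Sum>x\<in>S. local_time X T \<omega> x) = T"
  proof (rule LIMSEQ_unique[OF tendsto_sum[OF lim]])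
    have "(\<Sum>x\<in>S. \<Sum>k\<in>{1..<n}. T / real n * indicator {x} (X (T / real n * real k) \<omega>)) =
        real (n - 1) * (T / real n)" for n
    proof -
      have "(\<Sum>k\<in>{1..<n}. \<Sum>x\<in>S. T / real n * indicator {x} (X (T / real n * real k) \<omega>)) =
          (\<Sum>k\<in>{1..<n}. T / real n)"
      proof (intro sum.cong refl)
        fix k assume "k \<in> {1..<n}"
        then have "X (T / real n * real k) \<omega> \<in> S" by (intro visits_in_range[OF \<omega> R T]) auto
        then show "(\<Sum>x\<in>S. T / real n * indicator {x} (X (T / real n * real k) \<omega>)) = T / real n"
          using S by (simp add: indicator_def of_bool_def if_distrib if_distribR cong: if_cong)
      qed
      then show ?thesis by (subst sum.swap) simp
    qed
    moreover have "(\<lambda>n. real (n - 1) * (T / real n)) \<longlonglongrightarrow> T"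
    proof (rule Lim_transform_eventually)
      show "(\<lambda>n. T - T / real n) \<longlonglongrightarrow> T"
        using tendsto_diff[OF tendsto_const lim_const_over_n[of T], of T] by simp
      show "\<forall>\<^sub>F n in sequentially. T - T / real n = real (n - 1) * (T / real n)"
        using eventually_gt_at_top[of 0] by eventually_elim (auto simp: field_simps of_nat_diff)
    qed
    ultimately show "(\<lambda>n. \<Sum>x\<in>S. \<Sum>k\<in>{1..<n}. T / real n * indicator {x} (X (T / real n * real k) \<omega>))
        \<longlonglongrightarrow> T" by simp
  qed
  ultimately show ?thesis
    using T by (auto simp: prob_measures_def occupation_def simp flip: sum_divide_distrib)
qed

section \<open>The Feynman--Kac bound\<close>

lemma cylinder_of_path:
  "\<omega> \<in> space (P a) \<Longrightarrow> \<omega> \<in> cylinder a h (map (\<lambda>k. X (h * real k) \<omega>) (rev [1..<Suc m]))"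
  by (induction m) (auto simp: Suc_le_eq)

text \<open>
  Discretize time with mesh \<open>h = T / n\<close>. The expectation of the discretized exponential over paths seen
  in \<open>S\<close> at all mesh points before \<open>T\<close> is at most \<open>(1 + e h)^{n-1} g(a) \<le> e^{e T} g(a)\<close> for every \<open>e > 0\<close>
  and large \<open>n\<close>; here \<open>g \<ge> 1\<close> at the final state allows inserting the factor \<open>g\<close>. The discretized
  exponentials converge on the event that the range is contained in \<open>S\<close>, so Fatou's lemma carries the
  bound to the limit, and then \<open>e \<rightarrow> 0\<close>.
\<close>

lemma Feynman_Kac_le:
  fixes g :: "'a \<Rightarrow> real"
  assumes S: "finite S" and a: "a \<in> S" and T: "0 < T" and g: "\<And>x. x \<in> S \<Longrightarrow> 1 \<le> g x"
  shows "(\<integral>\<^sup>+ \<omega>. ennreal (exp (- (\<Sum>x\<in>S. local_time X T \<omega> x * ((\<Sum>y\<in>S. A x y * g y) / g x))))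
      * indicator {\<omega>. chain_range X T \<omega> \<subseteq> S} \<omega> \<partial>P a) \<le> ennreal (g a)"
    (is "(\<integral>\<^sup>+ \<omega>. ?f \<omega> \<partial>P a) \<le> _")
proof -
  interpret prob_space "P a" by (rule prob_space)
  define V where "V x = - ((\<Sum>y\<in>S. A x y * g y) / g x)" for x
  define h where "h n = T / real n" for n
  define w where "w n x = exp (h n * V x)" for n x
  define L where "L n = {ys. set ys \<subseteq> S \<and> length ys = n - 1}" for n
  define Z where "Z n \<omega> = (\<Sum>ys\<in>L n. ennreal (prod_list (map (w n) ys)) * indicator (cylinder a (h n) ys) \<omega>)"
    for n \<omega>
  have h0: "0 \<le> h n" for n using T by (simp add: h_def)
  have finL: "finite (L n)" for n
    unfolding L_def by (rule finite_lists_length_eq[OF S])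
  have w0: "0 \<le> prod_list (map (w n) ys)" for n ys
    by (intro prod_list_nonneg) (auto simp: w_def)
  have [measurable]: "cylinder a (h n) ys \<in> sets (P a)" for n ys
    by (rule cylinder_sets[OF h0])
  have Z_meas[measurable]: "Z n \<in> borel_measurable (P a)" for n
    unfolding Z_def by measurable
  have pointwise: "?f \<omega> \<le> liminf (\<lambda>n. Z n \<omega>)" if \<omega>: "\<omega> \<in> space (P a)" for \<omega>
  proof (cases "chain_range X T \<omega> \<subseteq> S")
    case R: True
    define r where "r n x = (\<Sum>k\<in>{1..<n}. T / real n * indicator {x} (X (T / real n * real k) \<omega>))" for n x
    have "(\<lambda>n. ennreal (exp (\<Sum>x\<in>S. r n x * V x))) \<longlonglongrightarrow>
        ennreal (exp (\<Sum>x\<in>S. local_time X T \<omega> x * V x))"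
      unfolding r_def by (intro tendsto_intros local_time_Riemann[OF \<omega> T])
    then have "liminf (\<lambda>n. ennreal (exp (\<Sum>x\<in>S. r n x * V x))) =
        ennreal (exp (\<Sum>x\<in>S. local_time X T \<omega> x * V x))"
      by (rule lim_imp_Liminf[rotated]) simp
    then have "?f \<omega> = liminf (\<lambda>n. ennreal (exp (\<Sum>x\<in>S. r n x * V x)))"
      using R by (simp add: V_def sum_negf)
    also have "\<dots> \<le> liminf (\<lambda>n. Z n \<omega>)"
    proof (intro Liminf_mono)
      show "\<forall>\<^sub>F n in sequentially. ennreal (exp (\<Sum>x\<in>S. r n x * V x)) \<le> Z n \<omega>"
        using eventually_gt_at_top[of 0]
      proof eventually_elim
        case (elim n)
        \<comment> \<open>The observed states select the one term of \<open>Z n \<omega>\<close> that is needed.\<close>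
        define ys where "ys = map (\<lambda>k. X (h n * real k) \<omega>) (rev [1..<n])"
        have XS: "X (h n * real k) \<omega> \<in> S" if "k < n" for k
          unfolding h_def by (rule visits_in_range[OF \<omega> R T that])
        have "ys \<in> L n" using XS by (auto simp: L_def ys_def)
        have "\<omega> \<in> cylinder a (h n) ys"
          using cylinder_of_path[OF \<omega>, of "h n" "n - 1"] elim by (simp add: ys_def)
        have "(\<Sum>x\<in>S. r n x * V x) =
            (\<Sum>k\<in>{1..<n}. \<Sum>x\<in>S. h n * indicator {x} (X (h n * real k) \<omega>) * V x)"
          unfolding r_def h_def sum_distrib_right by (rule sum.swap)
        also have "\<dots> = (\<Sum>k\<in>{1..<n}. h n * V (X (h n * real k) \<omega>))"
          using S XS
          by (intro sum.cong refl)
            (simp add: indicator_def of_bool_def if_distrib if_distribR cong: if_cong)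
        finally have "exp (\<Sum>x\<in>S. r n x * V x) = (\<Prod>k\<in>{1..<n}. w n (X (h n * real k) \<omega>))"
          by (simp add: exp_sum w_def)
        also have "\<dots> = prod_list (map (w n) ys)"
          using prod.distinct_set_conv_list[of "rev [1..<n]" "\<lambda>k. w n (X (h n * real k) \<omega>)"]
          by (simp add: ys_def o_def)
        finally have "ennreal (exp (\<Sum>x\<in>S. r n x * V x)) =
            ennreal (prod_list (map (w n) ys)) * indicator (cylinder a (h n) ys) \<omega>"
          using \<open>\<omega> \<in> cylinder a (h n) ys\<close> by simp
        also have "\<dots> \<le> Z n \<omega>"
          unfolding Z_def by (rule member_le_sum[OF \<open>ys \<in> L n\<close> _ finL]) simp
        finally show ?case .
      qed
    qed
    finally show ?thesis .
  qed simp
  have bound: "(\<integral>\<^sup>+ \<omega>. ?f \<omega> \<partial>P a) \<le> ennreal (exp (e * T) * g a)" if e: "0 < e" for e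
  proof -
    have "\<forall>\<^sub>F n in sequentially. (\<integral>\<^sup>+ \<omega>. Z n \<omega> \<partial>P a) \<le> ennreal (exp (e * T) * g a)"
    proof -
      have "filterlim h (at_right 0) sequentially"
        unfolding filterlim_at h_def using T
        by (auto intro!: lim_const_over_n eventually_mono[OF eventually_gt_at_top[of 0]])
      moreover have "\<forall>\<^sub>F t in at_right 0. \<forall>x\<in>S.
          (\<Sum>y\<in>S. transition t x y * (exp (t * V y) * g y)) \<le> (1 + e * t) * g x"
      proof (rule transition_step_le[OF S g _ e])
        fix x assume "x \<in> S"
        then show "V x * g x = - (\<Sum>y\<in>S. A x y * g y)" using g[of x] by (simp add: V_def)
      qed
      ultimately have "\<forall>\<^sub>F n in sequentially. \<forall>x\<in>S.
          (\<Sum>y\<in>S. transition (h n) x y * (w n y * g y)) \<le> (1 + e * h n) * g x"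
        unfolding w_def by (rule eventually_compose_filterlim[rotated])
      then show ?thesis
        using eventually_gt_at_top[of 0]
      proof eventually_elim
        case (elim n)
        have "(\<integral>\<^sup>+ \<omega>. Z n \<omega> \<partial>P a) =
            (\<Sum>ys\<in>L n. ennreal (prod_list (map (w n) ys)) * emeasure (P a) (cylinder a (h n) ys))"
          unfolding Z_def by (simp add: nn_integral_sum nn_integral_cmult)
        also have "\<dots> = ennreal (\<Sum>ys\<in>L n. measure (P a) (cylinder a (h n) ys) * prod_list (map (w n) ys))"
          using w0 by (simp add: emeasure_eq_measure sum_ennreal mult.commute flip: ennreal_mult)
        also have "\<dots> \<le> ennreal (\<Sum>ys\<in>L n. measure (P a) (cylinder a (h n) ys) * prod_list (map (w n) ys)
            * g (hd (ys @ [a])))"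
        proof (intro ennreal_leI sum_mono)
          fix ys assume "ys \<in> L n"
          then have "hd (ys @ [a]) \<in> S" using a by (cases ys) (auto simp: L_def)
          from mult_left_mono[OF g[OF this], of "measure (P a) (cylinder a (h n) ys) * prod_list (map (w n) ys)"]
          show "measure (P a) (cylinder a (h n) ys) * prod_list (map (w n) ys) \<le>
              measure (P a) (cylinder a (h n) ys) * prod_list (map (w n) ys) * g (hd (ys @ [a]))"
            using w0 by simp
        qed
        also have "\<dots> \<le> ennreal ((1 + e * h n) ^ (n - 1) * g a)"
          unfolding L_def
          by (intro ennreal_leI cylinder_sum_le S a h0) (use elim e h0 in \<open>auto simp: w_def\<close>)
        also have "\<dots> \<le> ennreal (exp (e * T) * g a)"
        proof (intro ennreal_leI mult_right_mono)
          have "(1 + e * h n) ^ (n - 1) \<le> exp (e * h n) ^ (n - 1)"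
            using e h0[of n] by (intro power_mono exp_ge_add_one_self) auto
          also have "\<dots> \<le> exp (e * h n) ^ n"
            using e h0[of n] by (intro power_increasing) auto
          also have "\<dots> = exp (e * T)"
            using elim by (simp add: h_def flip: exp_of_nat_mult)
          finally show "(1 + e * h n) ^ (n - 1) \<le> exp (e * T)" .
          show "0 \<le> g a" using g[OF a] by simp
        qed
        finally show ?case .
      qed
    qed
    then have "liminf (\<lambda>n. \<integral>\<^sup>+ \<omega>. Z n \<omega> \<partial>P a) \<le> ennreal (exp (e * T) * g a)"
      by (intro Liminf_le) auto
    moreover have "(\<integral>\<^sup>+ \<omega>. ?f \<omega> \<partial>P a) \<le> (\<integral>\<^sup>+ \<omega>. liminf (\<lambda>n. Z n \<omega>) \<partial>P a)"
      by (rule nn_integral_mono[OF pointwise])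
    moreover have "(\<integral>\<^sup>+ \<omega>. liminf (\<lambda>n. Z n \<omega>) \<partial>P a) \<le> liminf (\<lambda>n. \<integral>\<^sup>+ \<omega>. Z n \<omega> \<partial>P a)"
      by (rule nn_integral_liminf[OF Z_meas])
    ultimately show ?thesis by order
  qed
  have "((\<lambda>e. ennreal (exp (e * T) * g a)) \<longlongrightarrow> ennreal (exp (0 * T) * g a)) (at_right 0)"
    by (intro tendsto_intros)
  then have "(\<integral>\<^sup>+ \<omega>. ?f \<omega> \<partial>P a) \<le> ennreal (exp (0 * T) * g a)"
    by (rule tendsto_lowerbound[OF _ eventually_mono[OF eventually_at_right_less bound]]) auto
  then show ?thesis by simp
qed

section \<open>The exponential moment of the Dirichlet form\<close>

lemma occupation_measurable:
  assumes "0 < T"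
  shows "(\<lambda>\<omega>. occupation X T \<omega> x) \<in> borel_measurable (P a)"
  unfolding occupation_def using local_time_measurable[OF assms] by measurable

text \<open>
  On the event, the rounding of \<open>\<surd>\<ell>\<close> selects one \<open>g\<close> for which \<open>e^{|S| K / N} Y g\<close> dominates the integrand,
  where \<open>K = \<eta> T\<close>. With this factor, the sum over the whole grid dominates it on every path, and each of its terms is
  controlled by the Feynman--Kac bound.
\<close>

lemma exponential_moment_rate_le:
  assumes S: "finite S" and a: "a \<in> S" and T: "1 \<le> T"
  shows "(\<integral>\<^sup>+ \<omega>. ennreal (exp (T * dirichlet A S (occupation X T \<omega>)))
      * indicator {\<omega>. chain_range X T \<omega> \<subseteq> S} \<omega> \<partial>P a)
    \<le> ennreal (real (card S) * (eta A S * sqrt (8 * exp 1) * T) ^ card S)"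
proof -
  have T0: "0 < T" using T by simp
  define K where "K = eta A S * T"
  have \<eta>1: "1 \<le> eta A S" by (simp add: eta_def)
  have K: "1 \<le> K" unfolding K_def using mult_mono[OF \<eta>1 T] \<eta>1 by simp
  obtain N where N: "1 \<le> N" "real N * exp (K / real N) \<le> sqrt (8 * exp 1) * K"
    by (rule grid_size_exists[OF K])
  have A0: "0 \<le> A x y" if "x \<noteq> y" for x y
    using conservative that by (simp add: conservative_generator_def)
  have \<eta>: "(\<Sum>y\<in>S - {x}. A x y) \<le> eta A S" if "x \<in> S" for x
  proof -
    have "(\<Sum>y\<in>S - {x}. A x y) = (\<Sum>y\<in>S - {x}. \<bar>off_diagonal A x y\<bar>)"
      by (intro sum.cong) (auto simp: off_diagonal_def A0)
    also have "\<dots> \<le> Max ((\<lambda>x. \<Sum>y\<in>S - {x}. \<bar>off_diagonal A x y\<bar>) ` S)"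
      using S that by (intro Max_ge) auto
    finally show ?thesis by (simp add: eta_def)
  qed
  define Y where "Y g \<omega> = ennreal (exp (- (\<Sum>x\<in>S. local_time X T \<omega> x *
      ((\<Sum>y\<in>S. A x y * real (g y)) / real (g x)))))
      * indicator {\<omega>. chain_range X T \<omega> \<subseteq> S} \<omega>" for g :: "'a \<Rightarrow> nat" and \<omega>
  have Ym: "Y g \<in> borel_measurable (P a)" for g
  proof -
    have [measurable]: "(\<lambda>\<omega>. local_time X T \<omega> x) \<in> borel_measurable (P a)" for x
      by (rule local_time_measurable[OF T0])
    have [measurable]: "(\<lambda>\<omega>. indicator {\<omega>. chain_range X T \<omega> \<subseteq> S} \<omega> :: ennreal)
        \<in> borel_measurable (P a)"
      using chain_range_measurable[OF T0, of a S] by (subst borel_measurable_indicator_iff)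
        (auto simp: Int_def conj_commute)
    show ?thesis unfolding Y_def by measurable
  qed
  have pointwise: "ennreal (exp (T * dirichlet A S (occupation X T \<omega>)))
      * indicator {\<omega>. chain_range X T \<omega> \<subseteq> S} \<omega>
      \<le> ennreal (exp (real (card S) * (K / real N))) * (\<Sum>g\<in>grid S N. Y g \<omega>)"
    if \<omega>: "\<omega> \<in> space (P a)" for \<omega>
  proof (cases "chain_range X T \<omega> \<subseteq> S")
    case R: True
    define l where "l = local_time X T \<omega>"
    have occ: "occupation X T \<omega> \<in> prob_measures S"
      by (rule occupation_prob_measures[OF \<omega> R T0 S])
    have l0: "0 \<le> l x" for x
      using occ T0 by (auto simp: prob_measures_def occupation_def l_def zero_le_divide_iff not_le dest: spec[of _ x])
    have lT: "(\<Sum>x\<in>S. l x) = T"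
      using occ T0 by (simp add: prob_measures_def occupation_def l_def flip: sum_divide_distrib)
    obtain g where g: "g \<in> grid S N" "- (\<Sum>x\<in>S. \<Sum>y\<in>S. A x y * sqrt (l x) * sqrt (l y)) \<le>
        - (\<Sum>x\<in>S. l x * ((\<Sum>y\<in>S. A x y * real (g y)) / real (g x)))
        + real (card S) * (eta A S * T / real N)"
      by (rule grid_approximation[OF S N(1), of A "eta A S" l T])
        (use A0 \<eta> \<eta>1 l0 lT T0 in auto)
    have "T * dirichlet A S (occupation X T \<omega>) =
        - (\<Sum>x\<in>S. \<Sum>y\<in>S. A x y * sqrt (l x) * sqrt (l y))"
      using T0 by (simp add: dirichlet_def occupation_def l_def real_sqrt_divide sum_distrib_left)
    with g(2) have "exp (T * dirichlet A S (occupation X T \<omega>)) \<le>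
        exp (real (card S) * (K / real N) - (\<Sum>x\<in>S. l x * ((\<Sum>y\<in>S. A x y * real (g y)) / real (g x))))"
      by (simp add: K_def)
    then have "ennreal (exp (T * dirichlet A S (occupation X T \<omega>))) \<le>
        ennreal (exp (real (card S) * (K / real N))) * Y g \<omega>"
      using R by (simp add: Y_def l_def ennreal_leI flip: ennreal_mult exp_add)
    also have "Y g \<omega> \<le> (\<Sum>g\<in>grid S N. Y g \<omega>)"
      by (rule member_le_sum[OF g(1) _ finite_grid[OF S]]) simp
    finally show ?thesis using R by (simp add: mult_left_mono)
  qed simp
  have Y_le: "(\<integral>\<^sup>+ \<omega>. Y g \<omega> \<partial>P a) \<le> ennreal (real N)" if g: "g \<in> grid S N" for g
  proof -
    have "(\<integral>\<^sup>+ \<omega>. Y g \<omega> \<partial>P a) \<le> ennreal (real (g a))"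
      unfolding Y_def by (rule Feynman_Kac_le[OF S a T0]) (use grid_bounds[OF g N(1)] in simp)
    also have "\<dots> \<le> ennreal (real N)"
      using grid_bounds(2)[OF g N(1) a] by (intro ennreal_leI) simp
    finally show ?thesis .
  qed
  have "(\<integral>\<^sup>+ \<omega>. ennreal (exp (T * dirichlet A S (occupation X T \<omega>)))
      * indicator {\<omega>. chain_range X T \<omega> \<subseteq> S} \<omega> \<partial>P a)
    \<le> (\<integral>\<^sup>+ \<omega>. ennreal (exp (real (card S) * (K / real N))) * (\<Sum>g\<in>grid S N. Y g \<omega>) \<partial>P a)"
    by (rule nn_integral_mono[OF pointwise])
  also have "\<dots> = ennreal (exp (real (card S) * (K / real N))) * (\<Sum>g\<in>grid S N. \<integral>\<^sup>+ \<omega>. Y g \<omega> \<partial>P a)"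
    using Ym by (subst nn_integral_cmult) (auto simp: nn_integral_sum)
  also have "\<dots> \<le> ennreal (exp (real (card S) * (K / real N))) * (\<Sum>g\<in>grid S N. ennreal (real N))"
    by (intro mult_left_mono sum_mono Y_le) auto
  also have "\<dots> = ennreal (exp (real (card S) * (K / real N)) * (real (card (grid S N)) * real N))"
    by (simp add: ennreal_mult' ennreal_of_nat_eq_real_of_nat)
  also have "\<dots> \<le> ennreal (real (card S) * (eta A S * sqrt (8 * exp 1) * T) ^ card S)"
  proof (rule ennreal_leI)
    have "card S \<noteq> 0" using S a by auto
    have "real (card (grid S N)) * real N \<le> real (card S * N ^ (card S - 1)) * real N"
      using card_grid_le[OF S, of N] by (intro mult_right_mono) (simp_all only: of_nat_le_iff of_nat_0_le_iff)
    also have "\<dots> = real (card S) * real N ^ card S"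
      using \<open>card S \<noteq> 0\<close> by (cases "card S") (auto simp: algebra_simps)
    finally have "exp (real (card S) * (K / real N)) * (real (card (grid S N)) * real N)
        \<le> exp (real (card S) * (K / real N)) * (real (card S) * real N ^ card S)"
      by (intro mult_left_mono) auto
    also have "\<dots> = real (card S) * (real N * exp (K / real N)) ^ card S"
      by (simp add: exp_of_nat_mult power_mult_distrib del: times_divide_eq_right)
    also have "\<dots> \<le> real (card S) * (sqrt (8 * exp 1) * K) ^ card S"
      by (intro mult_left_mono power_mono N(2)) auto
    finally show "exp (real (card S) * (K / real N)) * (real (card (grid S N)) * real N)
        \<le> real (card S) * (eta A S * sqrt (8 * exp 1) * T) ^ card S"
      by (simp add: K_def mult_ac)
  qed
  finally show ?thesis .
qed

text \<open>
  The common source of both bounds: \<open>r\<close> stands for \<open>- inf I\<close> over \<open>\<Gamma>\<close> in one case and for \<open>sup (F - I)\<close>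
  over all probability measures on \<open>S\<close> in the other.
\<close>

lemma ln_nn_integral_le:
  assumes S: "finite S" and a: "a \<in> S" and T: "1 \<le> T"
    and f: "\<And>\<omega>. \<omega> \<in> space (P a) \<Longrightarrow> f \<omega> \<le> ennreal (exp (T * (r + dirichlet A S (occupation X T \<omega>))))
      * indicator {\<omega>. chain_range X T \<omega> \<subseteq> S} \<omega>"
  shows "ln_ennreal (\<integral>\<^sup>+ \<omega>. f \<omega> \<partial>P a) \<le> ereal (T * r)
    + ereal (real (card S) * ln (eta A S * sqrt (8 * exp 1) * T)
             + ln (real (card S)) + real (card S) / (4 * T))"
proof -
  have T0: "0 < T" using T by simp
  define c where "c = eta A S * sqrt (8 * exp 1) * T"
  have c: "0 < c" using T0 by (simp add: c_def eta_def less_max_iff_disj)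
  have n: "0 < real (card S)" using S a by (auto simp: card_gt_0_iff)
  define Y where "Y \<omega> = ennreal (exp (T * dirichlet A S (occupation X T \<omega>)))
      * indicator {\<omega>. chain_range X T \<omega> \<subseteq> S} \<omega>" for \<omega>
  have [measurable]: "(\<lambda>\<omega>. occupation X T \<omega> x) \<in> borel_measurable (P a)" for x
    by (rule occupation_measurable[OF T0])
  have [measurable]: "(\<lambda>\<omega>. indicator {\<omega>. chain_range X T \<omega> \<subseteq> S} \<omega> :: ennreal)
      \<in> borel_measurable (P a)"
    using chain_range_measurable[OF T0, of a S] by (subst borel_measurable_indicator_iff)
      (auto simp: Int_def conj_commute)
  have Ym[measurable]: "Y \<in> borel_measurable (P a)"
    unfolding Y_def dirichlet_def by measurable
  have "(\<integral>\<^sup>+ \<omega>. f \<omega> \<partial>P a) \<le> (\<integral>\<^sup>+ \<omega>. ennreal (exp (T * r)) * Y \<omega> \<partial>P a)"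
  proof (rule nn_integral_mono)
    fix \<omega> assume "\<omega> \<in> space (P a)"
    from f[OF this] show "f \<omega> \<le> ennreal (exp (T * r)) * Y \<omega>"
      by (simp add: Y_def distrib_left exp_add ennreal_mult mult.assoc)
  qed
  also have "\<dots> = ennreal (exp (T * r)) * (\<integral>\<^sup>+ \<omega>. Y \<omega> \<partial>P a)"
    by (rule nn_integral_cmult[OF Ym])
  also have "\<dots> \<le> ennreal (exp (T * r)) * ennreal (real (card S) * c ^ card S)"
    unfolding Y_def c_def by (intro mult_left_mono exponential_moment_rate_le S a T) simp
  also have "\<dots> = ennreal (exp (T * r) * (real (card S) * c ^ card S))"
    by (simp add: ennreal_mult')
  also have "\<dots> \<le> ennreal (exp (T * r + (real (card S) * ln c + ln (real (card S)) + real (card S) / (4 * T))))"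
  proof (rule ennreal_leI)
    have "real (card S) * c ^ card S = exp (real (card S) * ln c + ln (real (card S)))"
      using c n by (simp add: exp_add exp_of_nat_mult)
    also have "\<dots> \<le> exp (real (card S) * ln c + ln (real (card S)) + real (card S) / (4 * T))"
      using T0 by simp
    finally show "exp (T * r) * (real (card S) * c ^ card S)
        \<le> exp (T * r + (real (card S) * ln c + ln (real (card S)) + real (card S) / (4 * T)))"
      by (simp add: exp_add mult_left_mono)
  qed
  finally show ?thesis
    using ln_ennreal_le unfolding c_def by (simp only: plus_ereal.simps)
qed

end

section \<open>The large deviation bounds\<close>

theorem theorem3p6:
  fixes A :: "'a::countable \<Rightarrow> 'a \<Rightarrow> real"
    and P :: "'a \<Rightarrow> 'w measure"
    and X :: "real \<Rightarrow> 'w \<Rightarrow> 'a"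
    and S :: "'a set"
    and T :: real
    and a :: 'a
  assumes "\<exists>x y :: 'a. x \<noteq> y"
    and "markov_chain_with_generator A P X"
    and "\<forall>x y. A x y = A y x"
    and "finite S"
    and "T \<ge> 1"
    and "a \<in> S"
  shows
    "(\<forall>\<Gamma> \<in> sets (prob_measures_space S).
        ln_ennreal (emeasure (P a)
          {\<omega> \<in> space (P a). occupation X T \<omega> \<in> \<Gamma> \<and> chain_range X T \<omega> \<subseteq> S})
        \<le> - (ereal T * (INF \<mu>\<in>\<Gamma>. ereal (dirichlet A S \<mu>)))
          + ereal (real (card S) * ln (eta A S * sqrt (8 * exp 1) * T)
                   + ln (real (card S)) + real (card S) / (4 * T))) \<and>
     (\<forall>F \<in> borel_measurable (prob_measures_space S).
        ln_ennreal (\<integral>\<^sup>+ \<omega>. ennreal (exp (T * F (occupation X T \<omega>))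
                              * indicator {\<omega>. chain_range X T \<omega> \<subseteq> S} \<omega>) \<partial>P a)
        \<le> ereal T * (SUP \<mu>\<in>prob_measures S. ereal (F \<mu> - dirichlet A S \<mu>))
          + ereal (real (card S) * ln (eta A S * sqrt (8 * exp 1) * T)
                   + ln (real (card S)) + real (card S) / (4 * T)))"
proof (intro conjI ballI)
  interpret markov_chain_with_generator A P X by fact
  note S = \<open>finite S\<close> and a = \<open>a \<in> S\<close> and T = \<open>T \<ge> 1\<close>
  have T0: "0 < T" using T by simp
  let ?C = "real (card S) * ln (eta A S * sqrt (8 * exp 1) * T)
                   + ln (real (card S)) + real (card S) / (4 * T)"
  {
    fix \<Gamma>
    define E where "E = {\<omega> \<in> space (P a). occupation X T \<omega> \<in> \<Gamma> \<and> chain_range X T \<omega> \<subseteq> S}"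
    define I where "I = (INF \<mu>\<in>\<Gamma>. ereal (dirichlet A S \<mu>))"
    have "ln_ennreal (emeasure (P a) E) \<le> - (ereal T * I) + ereal ?C"
    \<comment> \<open>If \<open>E\<close> is not measurable, its measure is \<open>0\<close> by convention.\<close>
    proof (cases "E \<in> sets (P a) \<and> \<Gamma> \<noteq> {}")
      case False
      then have "emeasure (P a) E = 0" by (auto simp: E_def emeasure_notin_sets)
      then show ?thesis by (simp add: ln_ennreal_def)
    next
      case True
      then obtain \<mu> where "\<mu> \<in> \<Gamma>" by auto
      then have "I \<le> ereal (dirichlet A S \<mu>)" unfolding I_def by (rule INF_lower)
      show ?thesis
      proof (cases I)
        case (real i)
        have "ln_ennreal (\<integral>\<^sup>+ \<omega>. indicator E \<omega> \<partial>P a) \<le> ereal (T * - i) + ereal ?C"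
        proof (rule ln_nn_integral_le[OF S a T])
          fix \<omega> assume "\<omega> \<in> space (P a)"
          show "indicator E \<omega> \<le> ennreal (exp (T * (- i + dirichlet A S (occupation X T \<omega>))))
              * indicator {\<omega>. chain_range X T \<omega> \<subseteq> S} \<omega>"
          proof (cases "\<omega> \<in> E")
            case True
            then have "I \<le> ereal (dirichlet A S (occupation X T \<omega>))"
              unfolding I_def by (intro INF_lower) (simp add: E_def)
            then have "0 \<le> T * (- i + dirichlet A S (occupation X T \<omega>))"
              using real T0 by simp
            then show ?thesis using True by (simp add: E_def)
          qed simp
        qed
        then show ?thesis using True real by simp
      next
        case MInf
        then show ?thesis using T0 by simp
      qed (use \<open>I \<le> ereal (dirichlet A S \<mu>)\<close> in simp)
    qed
  }
  then show "ln_ennreal (emeasure (P a)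
        {\<omega> \<in> space (P a). occupation X T \<omega> \<in> \<Gamma> \<and> chain_range X T \<omega> \<subseteq> S})
      \<le> - (ereal T * (INF \<mu>\<in>\<Gamma>. ereal (dirichlet A S \<mu>))) + ereal ?C" for \<Gamma>
    by blast
  fix F :: "('a \<Rightarrow> real) \<Rightarrow> real"
  define J where "J = (SUP \<mu>\<in>prob_measures S. ereal (F \<mu> - dirichlet A S \<mu>))"
  have J_ge: "ereal (F \<mu> - dirichlet A S \<mu>) \<le> J" if "\<mu> \<in> prob_measures S" for \<mu>
    unfolding J_def using that by (rule SUP_upper)
  show "ln_ennreal (\<integral>\<^sup>+ \<omega>. ennreal (exp (T * F (occupation X T \<omega>))
          * indicator {\<omega>. chain_range X T \<omega> \<subseteq> S} \<omega>) \<partial>P a) \<le> ereal T * J + ereal ?C"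
  proof (cases J)
    case (real j)
    have "ln_ennreal (\<integral>\<^sup>+ \<omega>. ennreal (exp (T * F (occupation X T \<omega>))
          * indicator {\<omega>. chain_range X T \<omega> \<subseteq> S} \<omega>) \<partial>P a) \<le> ereal (T * j) + ereal ?C"
    proof (rule ln_nn_integral_le[OF S a T])
      fix \<omega> assume \<omega>: "\<omega> \<in> space (P a)"
      show "ennreal (exp (T * F (occupation X T \<omega>)) * indicator {\<omega>. chain_range X T \<omega> \<subseteq> S} \<omega>)
          \<le> ennreal (exp (T * (j + dirichlet A S (occupation X T \<omega>))))
            * indicator {\<omega>. chain_range X T \<omega> \<subseteq> S} \<omega>"
      proof (cases "chain_range X T \<omega> \<subseteq> S")
        case True
        have "F (occupation X T \<omega>) \<le> j + dirichlet A S (occupation X T \<omega>)"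
          using J_ge[OF occupation_prob_measures[OF \<omega> True T0 S]] real by simp
        then show ?thesis using True T0 by (simp add: ennreal_leI)
      qed simp
    qed
    then show ?thesis using real by simp
  next
    case PInf
    then show ?thesis using T0 by simp
  next
    case MInf
    \<comment> \<open>The point mass at \<open>a\<close> shows that the supremum is not \<open>-\<infinity>\<close>.\<close>
    have "(\<lambda>x. if x = a then 1 else 0) \<in> prob_measures S"
      using S a by (auto simp: prob_measures_def)
    from J_ge[OF this] show ?thesis using MInf by simp
  qed
qed

end
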